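(* Let $\mathcal{S}=(S,\preceq,\lhd,\cdot,\varepsilon,0,I,R)$ be a modal FL-cover system. Then $$\mathbf{L}_{\mathcal{S}}=(\mathit{Prop}(\mathcal{S}),\subseteq,\otimes,1,\Rightarrow_l,\Rightarrow_r,0,!,?)$$ is a complete (i.e. order-complete) modal FL-algebra, where for propositions $X,Y$: $X\otimes Y=j{\uparrow}(X\cdot Y)$, $1={\uparrow}\varepsilon$, $X\Rightarrow_l Y=\{z\in S: z\cdot X\subseteq Y\}$, $X\Rightarrow_r Y=\{z\in S: X\cdot z\subseteq Y\}$, $!X=j{\uparrow}(X\cap I)$, and $?X=\langle R\rangle X=\{x\in S:\exists y\,(xRy \text{ and } y\in X)\}$; the lattice meet of a family of propositions is its intersection and the join is $j$ of its union, with top $S$ and bottom $j\emptyset$.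
   Context: Cover systems. A structure $(S,\preceq,\lhd)$ consists of a set $S$, a preorder $\preceq$ on $S$, and a relation $\lhd\subseteq S\times\mathcal{P}(S)$ ($x\lhd C$ reads "$C$ covers $x$", $C$ is an $x$-cover). For $X\subseteq S$, ${\uparrow}X=\{y:\exists x\in X,\ x\preceq y\}$; ${\uparrow}x={\uparrow}\{x\}$; $X$ is an up-set if ${\uparrow}X=X$. It is a cover system if for all $x$: (Existence) there is an $x$-cover $C\subseteq{\uparrow}x$; (Transitivity) if $x\lhd C$ and $y\lhd C_y$ for every $y\in C$, then $x\lhd\bigcup_{y\in C}C_y$; (Refinement) if $x\preceq y$ and $x\lhd C$ then there is $C'$ with $y\lhd C'$ and $C'\subseteq{\uparrow}C$. Define $jX=\{x\in S:\exists C\,(x\lhd C\subseteq X)\}$. A proposition is an up-set $X$ with $jX\subseteq X$; $\mathit{Prop}(\mathcal{S})$ is the set of propositions. For $X,Y\subseteq S$ and a binary operation $\cdot$ on $S$, $X\cdot Y=\{x\cdot y:x\in X,y\in Y\}$, $x\cdot Y=\{x\}\cdot Y$, $X\cdot y=X\cdot\{y\}$. A residuated cover system $(S,\preceq,\lhd,\cdot,\varepsilon)$ is a cover system with an associative operation $\cdot$, monotone w.r.t. $\preceq$ in each argument, with identity $\varepsilon$, such that $x\lhd C$ implies $x\cdot y\lhd C\cdot y$ and $y\cdot x\lhd y\cdot C$, and such that $x\lhd C\subseteq{\uparrow}\varepsilon$ implies $\varepsilon\preceq x$. A modal FL-cover system $(S,\preceq,\lhd,\cdot,\varepsilon,0,I,R)$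 has $0\in\mathit{Prop}(\mathcal{S})$, $I\subseteq{\uparrow}\varepsilon$, $R\subseteq S\times S$, such that: $(S,\preceq,\lhd,\cdot,\varepsilon)$ is a residuated cover system; $I$ is closed under $\cdot$ and contains $\varepsilon$; $\varepsilon\lhd I$; every $x\in I$ satisfies $x=x\cdot x$ and $x\cdot y=y\cdot x$ for all $y\in S$; if $x\preceq y$ and $xRz$ then there is $w$ with $z\preceq w$ and $yRw$; if some $x$-cover is included in $\langle R\rangle X$ then there is $y$ with $xRy$ and a $y$-cover included in $X$; if $x\in I$ and $yRz$ then $(x\cdot y)R(x\cdot z)$ and $(y\cdot x)R(z\cdot x)$; $R$ is reflexive and transitive; $xRy$ and $y\in 0$ imply $x\in 0$; $x\in0$ implies there is $y$ with $xRy$ and $y\lhd\emptyset$. Modal FL-algebras. A residuated lattice is $(L,\sqsubseteq,\otimes,1,\Rightarrow_l,\Rightarrow_r)$ with $(L,\sqsubseteq)$ a lattice, $(L,\otimes,1)$ a monoid with $\otimes$ monotone, and $a\sqsubseteq b\Rightarrow_l c$ iff $a\otimes b\sqsubseteq c$ iff $b\sqsubseteq a\Rightarrow_r c$. An FL-algebra is a residuated lattice with a distinguished element $0$. A modal FL-algebra is a bounded FL-algebra with unary operations $!,?$ such that for all $a,b$: (s1) $!a\sqsubseteq a$; (s2) $!a\sqsubseteq !!a$; (s3) $!1=1$; (s4) $!(a\sqcap b)=!a\otimes !b$; (s5) $!a\otimes b=b\otimes !a$; (c1) $!(a\Rightarrow_i b)\sqsubseteq ?a\Rightarrow_i ?b$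 for $i=l,r$; (c2) $a\sqsubseteq ?a$; (c3) $??a\sqsubseteq ?a$; (c4) $?0\sqsubseteq 0$; (c5) $0\sqsubseteq ?a$. *)

theory Defs
  imports "HOL-Algebra.Group"
begin

section \<open>Cover systems\<close>

record 'a cover_struct = "'a partial_object" +
  preord :: "('a \<times> 'a) set"
  cover_rel :: "('a \<times> 'a set) set"

abbreviation below :: "[('a, 'm) cover_struct_scheme, 'a, 'a] \<Rightarrow> bool" (infix \<open>\<preceq>\<index>\<close> 50)
  where "x \<preceq>\<^bsub>S\<^esub> y \<equiv> (x, y) \<in> preord S"

abbreviation covered :: "[('a, 'm) cover_struct_scheme, 'a, 'a set] \<Rightarrow> bool" (infix \<open>\<lhd>\<index>\<close> 50)
  where "x \<lhd>\<^bsub>S\<^esub> C \<equiv> (x, C) \<in> cover_rel S"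

definition up :: "[('a, 'm) cover_struct_scheme, 'a set] \<Rightarrow> 'a set" (\<open>\<up>\<index>_\<close> [81] 80)
  where "\<up>\<^bsub>S\<^esub>X = {y \<in> carrier S. \<exists>x\<in>X. x \<preceq>\<^bsub>S\<^esub> y}"

definition up_set :: "[('a, 'm) cover_struct_scheme, 'a set] \<Rightarrow> bool"
  where "up_set S X \<longleftrightarrow> X \<subseteq> carrier S \<and> \<up>\<^bsub>S\<^esub>X = X"

locale cover_system =
  fixes S (structure)
  assumes preorder: "preorder_on (carrier S) (preord S)"
    and cover_rel_subset: "cover_rel S \<subseteq> carrier S \<times> Pow (carrier S)"
    and existence: "x \<in> carrier S \<Longrightarrow> \<exists>C. x \<lhd> C \<and> C \<subseteq> \<up>{x}"
    and transitivity: "\<lbrakk>x \<lhd> C; \<And>y. y \<in> C \<Longrightarrow> y \<lhd> D y\<rbrakk> \<Longrightarrow> x \<lhd> (\<Union>y\<in>C. D y)"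
    and refinement: "\<lbrakk>x \<preceq> y; x \<lhd> C\<rbrakk> \<Longrightarrow> \<exists>C'. y \<lhd> C' \<and> C' \<subseteq> \<up>C"

definition j :: "[('a, 'm) cover_struct_scheme, 'a set] \<Rightarrow> 'a set"
  where "j S X = {x \<in> carrier S. \<exists>C. x \<lhd>\<^bsub>S\<^esub> C \<and> C \<subseteq> X}"

definition Prop :: "('a, 'm) cover_struct_scheme \<Rightarrow> 'a set set"
  where "Prop S = {X. up_set S X \<and> j S X \<subseteq> X}"

record 'a residuated_cover_struct = "'a cover_struct" +
  fusion :: "['a, 'a] \<Rightarrow> 'a" (infixl \<open>\<cdot>\<index>\<close> 70)
  ident :: 'a (\<open>\<epsilon>\<index>\<close>)

definition set_fusion ::
    "[('a, 'm) residuated_cover_struct_scheme, 'a set, 'a set] \<Rightarrow> 'a set" (infixl \<open>\<bullet>\<index>\<close> 70)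
  where "X \<bullet>\<^bsub>S\<^esub> Y = {x \<cdot>\<^bsub>S\<^esub> y | x y. x \<in> X \<and> y \<in> Y}"

locale residuated_cover_system = cover_system S for S (structure) +
  assumes fusion_monoid: "monoid \<lparr>carrier = carrier S, mult = (\<cdot>), one = \<epsilon>\<rparr>"
    and fusion_mono_left: "\<lbrakk>x \<preceq> y; z \<in> carrier S\<rbrakk> \<Longrightarrow> x \<cdot> z \<preceq> y \<cdot> z"
    and fusion_mono_right: "\<lbrakk>x \<preceq> y; z \<in> carrier S\<rbrakk> \<Longrightarrow> z \<cdot> x \<preceq> z \<cdot> y"
    and cover_fusion_right: "\<lbrakk>x \<lhd> C; y \<in> carrier S\<rbrakk> \<Longrightarrow> x \<cdot> y \<lhd> C \<bullet> {y}"
    and cover_fusion_left: "\<lbrakk>x \<lhd> C; y \<in> carrier S\<rbrakk> \<Longrightarrow> y \<cdot> x \<lhd> {y} \<bullet> C"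
    and cover_ident: "\<lbrakk>x \<lhd> C; C \<subseteq> \<up>{\<epsilon>}\<rbrakk> \<Longrightarrow> \<epsilon> \<preceq> x"

text \<open>The fields \<open>falsum\<close>, \<open>idems\<close> and \<open>acc\<close> are the components written \<open>0\<close>, \<open>I\<close>
  and \<open>R\<close> in the literature.\<close>

record 'a modal_FL_cover_struct = "'a residuated_cover_struct" +
  falsum :: "'a set"
  idems :: "'a set"
  acc :: "('a \<times> 'a) set"

definition dia :: "[('a, 'm) modal_FL_cover_struct_scheme, 'a set] \<Rightarrow> 'a set"
  where "dia S X = {x \<in> carrier S. \<exists>y. (x, y) \<in> acc S \<and> y \<in> X}"

locale modal_FL_cover_system = residuated_cover_system S for S (structure) +
  assumes falsum_Prop: "falsum S \<in> Prop S"
    and idems_subset: "idems S \<subseteq> \<up>{\<epsilon>}"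
    and acc_subset: "acc S \<subseteq> carrier S \<times> carrier S"
    and idems_closed: "\<lbrakk>x \<in> idems S; y \<in> idems S\<rbrakk> \<Longrightarrow> x \<cdot> y \<in> idems S"
    and ident_idems: "\<epsilon> \<in> idems S"
    and ident_cover: "\<epsilon> \<lhd> idems S"
    and idems_idem: "x \<in> idems S \<Longrightarrow> x = x \<cdot> x"
    and idems_central: "\<lbrakk>x \<in> idems S; y \<in> carrier S\<rbrakk> \<Longrightarrow> x \<cdot> y = y \<cdot> x"
    and acc_confluence: "\<lbrakk>x \<preceq> y; (x, z) \<in> acc S\<rbrakk> \<Longrightarrow> \<exists>w. z \<preceq> w \<and> (y, w) \<in> acc S"
    and acc_localisation:
      "\<lbrakk>X \<subseteq> carrier S; x \<lhd> C; C \<subseteq> dia S X\<rbrakk> \<Longrightarrow> \<exists>y D. (x, y) \<in> acc S \<and> y \<lhd> D \<and> D \<subseteq> X"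
    and acc_fusion_left: "\<lbrakk>x \<in> idems S; (y, z) \<in> acc S\<rbrakk> \<Longrightarrow> (x \<cdot> y, x \<cdot> z) \<in> acc S"
    and acc_fusion_right: "\<lbrakk>x \<in> idems S; (y, z) \<in> acc S\<rbrakk> \<Longrightarrow> (y \<cdot> x, z \<cdot> x) \<in> acc S"
    and acc_refl: "refl_on (carrier S) (acc S)"
    and acc_trans: "trans (acc S)"
    and acc_falsum: "\<lbrakk>(x, y) \<in> acc S; y \<in> falsum S\<rbrakk> \<Longrightarrow> x \<in> falsum S"
    and falsum_acc: "x \<in> falsum S \<Longrightarrow> \<exists>y. (x, y) \<in> acc S \<and> y \<lhd> {}"

section \<open>Modal FL-algebras\<close>

record 'a residuated_struct = "'a gorder" +
  tensor :: "['a, 'a] \<Rightarrow> 'a" (infixl \<open>\<odot>\<index>\<close> 70)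
  unit :: 'a (\<open>\<one>\<^sub>L\<index>\<close>)
  limp :: "['a, 'a] \<Rightarrow> 'a" (infixr \<open>\<Rightarrow>\<^sub>l\<index>\<close> 60)
  rimp :: "['a, 'a] \<Rightarrow> 'a" (infixr \<open>\<Rightarrow>\<^sub>r\<index>\<close> 60)

locale residuated_lattice = lattice L for L (structure) +
  assumes tensor_monoid: "monoid \<lparr>carrier = carrier L, mult = (\<odot>), one = \<one>\<^sub>L\<rparr>"
    and tensor_mono: "\<lbrakk>a \<in> carrier L; b \<in> carrier L; c \<in> carrier L; d \<in> carrier L;
        a \<sqsubseteq> b; c \<sqsubseteq> d\<rbrakk> \<Longrightarrow> a \<odot> c \<sqsubseteq> b \<odot> d"
    and limp_closed: "\<lbrakk>a \<in> carrier L; b \<in> carrier L\<rbrakk> \<Longrightarrow> a \<Rightarrow>\<^sub>l b \<in> carrier L"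
    and rimp_closed: "\<lbrakk>a \<in> carrier L; b \<in> carrier L\<rbrakk> \<Longrightarrow> a \<Rightarrow>\<^sub>r b \<in> carrier L"
    and limp_residual: "\<lbrakk>a \<in> carrier L; b \<in> carrier L; c \<in> carrier L\<rbrakk>
        \<Longrightarrow> a \<sqsubseteq> (b \<Rightarrow>\<^sub>l c) \<longleftrightarrow> a \<odot> b \<sqsubseteq> c"
    and rimp_residual: "\<lbrakk>a \<in> carrier L; b \<in> carrier L; c \<in> carrier L\<rbrakk>
        \<Longrightarrow> b \<sqsubseteq> (a \<Rightarrow>\<^sub>r c) \<longleftrightarrow> a \<odot> b \<sqsubseteq> c"

record 'a FL_struct = "'a residuated_struct" +
  zeroL :: 'a (\<open>\<zero>\<^sub>L\<index>\<close>)

locale FL_algebra = residuated_lattice L for L (structure) +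
  assumes zeroL_closed: "\<zero>\<^sub>L \<in> carrier L"

record 'a modal_FL_struct = "'a FL_struct" +
  bang :: "'a \<Rightarrow> 'a"
  quest :: "'a \<Rightarrow> 'a"

locale modal_FL_algebra = FL_algebra L + bounded_lattice L for L (structure) +
  assumes bang_closed: "a \<in> carrier L \<Longrightarrow> bang L a \<in> carrier L"
    and quest_closed: "a \<in> carrier L \<Longrightarrow> quest L a \<in> carrier L"
    and s1: "a \<in> carrier L \<Longrightarrow> bang L a \<sqsubseteq> a"
    and s2: "a \<in> carrier L \<Longrightarrow> bang L a \<sqsubseteq> bang L (bang L a)"
    and s3: "bang L \<one>\<^sub>L = \<one>\<^sub>L"
    and s4: "\<lbrakk>a \<in> carrier L; b \<in> carrier L\<rbrakk> \<Longrightarrow> bang L (a \<sqinter> b) = bang L a \<odot> bang L b"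
    and s5: "\<lbrakk>a \<in> carrier L; b \<in> carrier L\<rbrakk> \<Longrightarrow> bang L a \<odot> b = b \<odot> bang L a"
    and c1_l: "\<lbrakk>a \<in> carrier L; b \<in> carrier L\<rbrakk>
        \<Longrightarrow> bang L (a \<Rightarrow>\<^sub>l b) \<sqsubseteq> (quest L a \<Rightarrow>\<^sub>l quest L b)"
    and c1_r: "\<lbrakk>a \<in> carrier L; b \<in> carrier L\<rbrakk>
        \<Longrightarrow> bang L (a \<Rightarrow>\<^sub>r b) \<sqsubseteq> (quest L a \<Rightarrow>\<^sub>r quest L b)"
    and c2: "a \<in> carrier L \<Longrightarrow> a \<sqsubseteq> quest L a"
    and c3: "a \<in> carrier L \<Longrightarrow> quest L (quest L a) \<sqsubseteq> quest L a"
    and c4: "quest L \<zero>\<^sub>L \<sqsubseteq> \<zero>\<^sub>L"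
    and c5: "a \<in> carrier L \<Longrightarrow> \<zero>\<^sub>L \<sqsubseteq> quest L a"

section \<open>The algebra of propositions\<close>

definition prop_algebra ::
    "('a, 'm) modal_FL_cover_struct_scheme \<Rightarrow> 'a set modal_FL_struct" (\<open>\<^bold>L\<close>)
  where "\<^bold>L S =
    \<lparr>carrier = Prop S, eq = (=), le = (\<subseteq>),
     tensor = (\<lambda>X Y. j S (\<up>\<^bsub>S\<^esub>(X \<bullet>\<^bsub>S\<^esub> Y))),
     unit = \<up>\<^bsub>S\<^esub>{\<epsilon>\<^bsub>S\<^esub>},
     limp = (\<lambda>X Y. {z \<in> carrier S. {z} \<bullet>\<^bsub>S\<^esub> X \<subseteq> Y}),
     rimp = (\<lambda>X Y. {z \<in> carrier S. X \<bullet>\<^bsub>S\<^esub> {z} \<subseteq> Y}),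
     zeroL = falsum S,
     bang = (\<lambda>X. j S (\<up>\<^bsub>S\<^esub>(X \<inter> idems S))),
     quest = (\<lambda>X. dia S X)\<rparr>"

end

theory Submission
  imports Defs
begin

text \<open>The map taking \<open>X\<close> to \<open>j \<up>X\<close> is a closure operator on subsets of the carrier whose
  closed sets are the propositions. Since covers are stable under fusion, it is moreover a
  nucleus: the closure of a fusion of sets does not change when the factors are replaced by
  their closures. Hence all equations about \<open>\<otimes>\<close> and \<open>!\<close> reduce to equations between plain
  complex products of sets, where \<open>I\<close> consists of central idempotents above \<open>\<epsilon>\<close>.\<close>

section \<open>Closure in cover systems\<close>

context cover_system
begin

lemma below_carrier: "x \<preceq> y \<Longrightarrow> x \<in> carrier S \<and> y \<in> carrier S"
  using preorder by (auto simp: preorder_on_def)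

lemma below_refl: "x \<in> carrier S \<Longrightarrow> x \<preceq> x"
  using preorder by (auto simp: preorder_on_def refl_on_def)

lemma below_trans: "x \<preceq> y \<Longrightarrow> y \<preceq> z \<Longrightarrow> x \<preceq> z"
  using preorder by (auto simp: preorder_on_def dest: transD)

lemma cover_carrier: "x \<lhd> C \<Longrightarrow> x \<in> carrier S \<and> C \<subseteq> carrier S"
  using cover_rel_subset by auto

lemma subset_up: "X \<subseteq> carrier S \<Longrightarrow> X \<subseteq> \<up>X"
  by (auto simp: up_def intro: below_refl)

lemma up_setI:
  assumes "X \<subseteq> carrier S" and "\<And>x y. x \<in> X \<Longrightarrow> x \<preceq> y \<Longrightarrow> y \<in> X"
  shows "up_set S X"
  using assms subset_up[of X] by (auto simp: up_set_def up_def)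

lemma up_setD: "up_set S X \<Longrightarrow> x \<in> X \<Longrightarrow> x \<preceq> y \<Longrightarrow> y \<in> X"
  using below_carrier by (auto simp: up_set_def up_def)

lemma up_set_up: "up_set S (\<up>X)"
  by (rule up_setI) (auto simp: up_def dest: below_trans below_carrier)

lemma up_subset_iff: "X \<subseteq> carrier S \<Longrightarrow> up_set S Z \<Longrightarrow> \<up>X \<subseteq> Z \<longleftrightarrow> X \<subseteq> Z"
  using subset_up[of X] up_setD[of Z] by (auto simp: up_def)

lemma j_mono: "X \<subseteq> Y \<Longrightarrow> j S X \<subseteq> j S Y"
  by (auto simp: j_def)

text \<open>Existence supplies a cover of \<open>x\<close> inside the cone above \<open>x\<close>,
  and an up-set containing \<open>x\<close> contains that whole cone.\<close>

lemma subset_j: "up_set S X \<Longrightarrow> X \<subseteq> j S X"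
proof
  fix x assume X: "up_set S X" and x: "x \<in> X"
  then have "x \<in> carrier S" by (auto simp: up_set_def)
  moreover from this obtain C where "x \<lhd> C" "C \<subseteq> \<up>{x}" using existence by blast
  moreover have "\<up>{x} \<subseteq> X" using X x up_subset_iff[of "{x}" X] \<open>x \<in> carrier S\<close> by blast
  ultimately show "x \<in> j S X" by (auto simp: j_def)
qed

lemma up_set_j:
  assumes "up_set S X"
  shows "up_set S (j S X)"
proof (rule up_setI)
  show "j S X \<subseteq> carrier S" by (auto simp: j_def)
next
  fix x y assume "x \<in> j S X" and xy: "x \<preceq> y"
  then obtain C where "x \<lhd> C" "C \<subseteq> X" by (auto simp: j_def)
  \<comment> \<open>Refinement pushes the cover of \<open>x\<close> to one of \<open>y\<close> lying
    in \<open>\<up>C\<close>; this is still inside \<open>X\<close> because \<open>X\<close> is an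
    up-set.\<close>
  with refinement[OF xy] obtain C' where C': "y \<lhd> C'" "C' \<subseteq> \<up>C" by blast
  have "\<up>C \<subseteq> X" using \<open>C \<subseteq> X\<close> assms by (auto simp: up_set_def up_def)
  then show "y \<in> j S X" using C' cover_carrier by (fastforce simp: j_def)
qed

text \<open>This is Transitivity: choose for each \<open>y\<close> in the cover \<open>C\<close> a
  cover \<open>D y\<close> inside \<open>X\<close> and glue them into one cover of
  \<open>x\<close>.\<close>

lemma j_idem: "j S (j S X) \<subseteq> j S X"
proof
  fix x assume "x \<in> j S (j S X)"
  then obtain C where x: "x \<lhd> C" and C: "C \<subseteq> j S X" by (auto simp: j_def)
  then have "\<forall>y\<in>C. \<exists>D. y \<lhd> D \<and> D \<subseteq> X" by (auto simp: j_def)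
  then obtain D where D: "\<And>y. y \<in> C \<Longrightarrow> y \<lhd> D y \<and> D y \<subseteq> X" by metis
  with transitivity[OF x] have "x \<lhd> (\<Union>y\<in>C. D y)" by blast
  moreover have "(\<Union>y\<in>C. D y) \<subseteq> X" using D by blast
  ultimately show "x \<in> j S X" using cover_carrier by (auto simp: j_def)
qed

section \<open>Propositions as closed sets\<close>

lemma Prop_carrier: "X \<in> Prop S \<Longrightarrow> X \<subseteq> carrier S"
  by (auto simp: Prop_def up_set_def)

lemma Prop_upward: "X \<in> Prop S \<Longrightarrow> x \<in> X \<Longrightarrow> x \<preceq> y \<Longrightarrow> y \<in> X"
  by (auto simp: Prop_def dest: up_setD)

lemma Prop_cover: "X \<in> Prop S \<Longrightarrow> x \<lhd> C \<Longrightarrow> C \<subseteq> X \<Longrightarrow> x \<in> X"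
  using cover_carrier by (fastforce simp: Prop_def j_def)

lemma PropI:
  assumes "X \<subseteq> carrier S"
    and "\<And>x y. x \<in> X \<Longrightarrow> x \<preceq> y \<Longrightarrow> y \<in> X"
    and "\<And>x C. x \<lhd> C \<Longrightarrow> C \<subseteq> X \<Longrightarrow> x \<in> X"
  shows "X \<in> Prop S"
  using assms up_setI[of X] by (auto simp: Prop_def j_def)

lemma j_Prop: "up_set S X \<Longrightarrow> j S X \<in> Prop S"
  using up_set_j j_idem by (auto simp: Prop_def)

lemma closure_Prop: "j S (\<up>X) \<in> Prop S"
  by (rule j_Prop[OF up_set_up])

lemma j_subset_iff: "up_set S X \<Longrightarrow> Z \<in> Prop S \<Longrightarrow> j S X \<subseteq> Z \<longleftrightarrow> X \<subseteq> Z"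
  using subset_j j_mono[of X Z] by (fastforce simp: Prop_def)

text \<open>The universal property of the closure: an inclusion of a closure in a proposition has to
  be checked only on generators. Extensivity, monotonicity and most later inclusions follow from
  it.\<close>

lemma closure_subset_iff:
  "X \<subseteq> carrier S \<Longrightarrow> Z \<in> Prop S \<Longrightarrow> j S (\<up>X) \<subseteq> Z \<longleftrightarrow> X \<subseteq> Z"
  using up_subset_iff j_subset_iff[OF up_set_up] by (auto simp: Prop_def)

lemma closure_extensive: "X \<subseteq> carrier S \<Longrightarrow> X \<subseteq> j S (\<up>X)"
  using closure_subset_iff closure_Prop by blast

lemma closure_mono: "X \<subseteq> Y \<Longrightarrow> Y \<subseteq> carrier S \<Longrightarrow> j S (\<up>X) \<subseteq> j S (\<up>Y)"
  by (meson closure_Prop closure_extensive closure_subset_iff order_trans)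

lemma closure_Prop_eq: "X \<in> Prop S \<Longrightarrow> j S (\<up>X) = X"
  by (meson Prop_carrier closure_extensive closure_subset_iff subset_antisym subset_refl)

lemma carrier_Prop: "carrier S \<in> Prop S"
  by (rule PropI) (auto dest: below_carrier cover_carrier)

text \<open>Both closure conditions pass to intersections. Cutting down to the carrier matters only
  for the empty family, where it yields the top proposition.\<close>

lemma Inter_Prop: "A \<subseteq> Prop S \<Longrightarrow> carrier S \<inter> \<Inter>A \<in> Prop S"
proof (rule PropI)
  fix x y assume "A \<subseteq> Prop S" "x \<in> carrier S \<inter> \<Inter>A" "x \<preceq> y"
  then show "y \<in> carrier S \<inter> \<Inter>A" using Prop_upward below_carrier by blast
next
  fix x C assume "A \<subseteq> Prop S" "x \<lhd> C" "C \<subseteq> carrier S \<inter> \<Inter>A"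
  then show "x \<in> carrier S \<inter> \<Inter>A" using Prop_cover cover_carrier by blast
qed blast

text \<open>A union of propositions can fail to be closed under covers, but it stays upward closed;
  hence joins are obtained by applying \<open>j\<close> alone.\<close>

lemma Union_up_set: "A \<subseteq> Prop S \<Longrightarrow> up_set S (\<Union>A)"
  by (rule up_setI) (auto dest: Prop_carrier Prop_upward)

end

section \<open>The closure nucleus\<close>

context residuated_cover_system
begin

lemma fusion_closed: "x \<in> carrier S \<Longrightarrow> y \<in> carrier S \<Longrightarrow> x \<cdot> y \<in> carrier S"
  using monoid.m_closed[OF fusion_monoid] by simp

lemma fusion_assoc:
  "x \<in> carrier S \<Longrightarrow> y \<in> carrier S \<Longrightarrow> z \<in> carrier S \<Longrightarrow> x \<cdot> y \<cdot> z = x \<cdot> (y \<cdot> z)"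
  using monoid.m_assoc[OF fusion_monoid] by simp

lemma ident_closed: "\<epsilon> \<in> carrier S"
  using monoid.one_closed[OF fusion_monoid] by simp

lemma ident_left: "x \<in> carrier S \<Longrightarrow> \<epsilon> \<cdot> x = x"
  using monoid.l_one[OF fusion_monoid] by simp

lemma ident_right: "x \<in> carrier S \<Longrightarrow> x \<cdot> \<epsilon> = x"
  using monoid.r_one[OF fusion_monoid] by simp

section \<open>Complex products of subsets\<close>

lemma mem_set_fusion: "z \<in> X \<bullet> Y \<longleftrightarrow> (\<exists>x\<in>X. \<exists>y\<in>Y. z = x \<cdot> y)"
  by (auto simp: set_fusion_def)

lemma set_fusionI: "x \<in> X \<Longrightarrow> y \<in> Y \<Longrightarrow> x \<cdot> y \<in> X \<bullet> Y"
  by (auto simp: mem_set_fusion)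

lemma set_fusion_closed: "X \<subseteq> carrier S \<Longrightarrow> Y \<subseteq> carrier S \<Longrightarrow> X \<bullet> Y \<subseteq> carrier S"
  by (auto simp: mem_set_fusion subset_iff intro!: fusion_closed)

lemma set_fusion_mono: "X \<subseteq> X' \<Longrightarrow> Y \<subseteq> Y' \<Longrightarrow> X \<bullet> Y \<subseteq> X' \<bullet> Y'"
  by (fastforce simp: mem_set_fusion)

lemma set_fusion_assoc:
  assumes "X \<subseteq> carrier S" "Y \<subseteq> carrier S" "Z \<subseteq> carrier S"
  shows "X \<bullet> Y \<bullet> Z = X \<bullet> (Y \<bullet> Z)"
proof -
  have assoc: "x \<cdot> y \<cdot> z = x \<cdot> (y \<cdot> z)" if "x \<in> X" "y \<in> Y" "z \<in> Z" for x y z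
    using that assms by (intro fusion_assoc) auto
  show ?thesis
  proof (intro subset_antisym subsetI)
    fix w assume "w \<in> X \<bullet> Y \<bullet> Z"
    then obtain x y z where "w = x \<cdot> y \<cdot> z" "x \<in> X" "y \<in> Y" "z \<in> Z"
      by (auto simp: mem_set_fusion)
    then show "w \<in> X \<bullet> (Y \<bullet> Z)" by (simp add: assoc set_fusionI)
  next
    fix w assume "w \<in> X \<bullet> (Y \<bullet> Z)"
    then obtain x y z where "w = x \<cdot> (y \<cdot> z)" "x \<in> X" "y \<in> Y" "z \<in> Z"
      by (auto simp: mem_set_fusion)
    then show "w \<in> X \<bullet> Y \<bullet> Z" by (simp flip: assoc add: set_fusionI)
  qed
qed

lemma set_fusion_ident_left: "X \<subseteq> carrier S \<Longrightarrow> {\<epsilon>} \<bullet> X = X"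
  by (auto simp: mem_set_fusion set_eq_iff ident_left subset_iff)

lemma set_fusion_ident_right: "X \<subseteq> carrier S \<Longrightarrow> X \<bullet> {\<epsilon>} = X"
  by (auto simp: mem_set_fusion set_eq_iff ident_right subset_iff)

text \<open>Monotonicity of fusion gives upward closure, and stability of covers under fusion on the
  right gives closure under covers. Letting \<open>X\<close> be any set of generators makes the
  nucleus property derivable from this.\<close>

lemma limp_Prop:
  assumes X: "X \<subseteq> carrier S" and Y: "Y \<in> Prop S"
  shows "{z \<in> carrier S. {z} \<bullet> X \<subseteq> Y} \<in> Prop S"
proof (rule PropI)
  fix x y assume x: "x \<in> {z \<in> carrier S. {z} \<bullet> X \<subseteq> Y}" and "x \<preceq> y"
  have "y \<cdot> w \<in> Y" if "w \<in> X" for w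
  proof (rule Prop_upward[OF Y])
    show "x \<cdot> w \<in> Y" using x that by (auto simp: mem_set_fusion subset_iff)
    show "x \<cdot> w \<preceq> y \<cdot> w" using \<open>x \<preceq> y\<close> that X by (auto intro: fusion_mono_left)
  qed
  then show "y \<in> {z \<in> carrier S. {z} \<bullet> X \<subseteq> Y}"
    using below_carrier[OF \<open>x \<preceq> y\<close>] by (auto simp: mem_set_fusion)
next
  fix x C assume x: "x \<lhd> C" and C: "C \<subseteq> {z \<in> carrier S. {z} \<bullet> X \<subseteq> Y}"
  have "x \<cdot> w \<in> Y" if "w \<in> X" for w
  proof (rule Prop_cover[OF Y])
    \<comment> \<open>Fusing the cover of \<open>x\<close> with \<open>w\<close> covers
      \<open>x \<cdot> w\<close>, and each of its members lies in \<open>Y\<close> by the choice of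
      \<open>C\<close>.\<close>
    show "x \<cdot> w \<lhd> C \<bullet> {w}" using cover_fusion_right[OF x] that X by blast
    show "C \<bullet> {w} \<subseteq> Y" using C that by (fastforce simp: mem_set_fusion)
  qed
  then show "x \<in> {z \<in> carrier S. {z} \<bullet> X \<subseteq> Y}"
    using cover_carrier[OF x] by (auto simp: mem_set_fusion)
qed blast

lemma rimp_Prop:
  assumes X: "X \<subseteq> carrier S" and Y: "Y \<in> Prop S"
  shows "{z \<in> carrier S. X \<bullet> {z} \<subseteq> Y} \<in> Prop S"
proof (rule PropI)
  fix x y assume x: "x \<in> {z \<in> carrier S. X \<bullet> {z} \<subseteq> Y}" and "x \<preceq> y"
  have "w \<cdot> y \<in> Y" if "w \<in> X" for w
  proof (rule Prop_upward[OF Y])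
    show "w \<cdot> x \<in> Y" using x that by (auto simp: mem_set_fusion subset_iff)
    show "w \<cdot> x \<preceq> w \<cdot> y" using \<open>x \<preceq> y\<close> that X by (auto intro: fusion_mono_right)
  qed
  then show "y \<in> {z \<in> carrier S. X \<bullet> {z} \<subseteq> Y}"
    using below_carrier[OF \<open>x \<preceq> y\<close>] by (auto simp: mem_set_fusion)
next
  fix x C assume x: "x \<lhd> C" and C: "C \<subseteq> {z \<in> carrier S. X \<bullet> {z} \<subseteq> Y}"
  have "w \<cdot> x \<in> Y" if "w \<in> X" for w
  proof (rule Prop_cover[OF Y])
    show "w \<cdot> x \<lhd> {w} \<bullet> C" using cover_fusion_left[OF x] that X by blast
    show "{w} \<bullet> C \<subseteq> Y" using C that by (fastforce simp: mem_set_fusion)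
  qed
  then show "x \<in> {z \<in> carrier S. X \<bullet> {z} \<subseteq> Y}"
    using cover_carrier[OF x] by (auto simp: mem_set_fusion)
qed blast

text \<open>Residuation for plain complex products. Together with the universal property of the
  closure it yields residuation for the tensor.\<close>

lemma subset_limp_iff:
  "X \<subseteq> carrier S \<Longrightarrow> X \<subseteq> {z \<in> carrier S. {z} \<bullet> Y \<subseteq> Z} \<longleftrightarrow> X \<bullet> Y \<subseteq> Z"
  by (fastforce simp: mem_set_fusion subset_iff)

lemma subset_rimp_iff:
  "Y \<subseteq> carrier S \<Longrightarrow> Y \<subseteq> {z \<in> carrier S. X \<bullet> {z} \<subseteq> Z} \<longleftrightarrow> X \<bullet> Y \<subseteq> Z"
  by (fastforce simp: mem_set_fusion subset_iff)

text \<open>By residuation both sides compare a set with the same residual. That residual is a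
  proposition, so it contains \<open>X\<close> exactly when it contains the closure of
  \<open>X\<close>.\<close>

lemma closure_fusion_subset_iff:
  assumes "X \<subseteq> carrier S" "Y \<subseteq> carrier S" "Z \<in> Prop S"
  shows "j S (\<up>X) \<bullet> Y \<subseteq> Z \<longleftrightarrow> X \<bullet> Y \<subseteq> Z"
  using subset_limp_iff[of X Y Z] subset_limp_iff[of "j S (\<up>X)" Y Z]
    closure_subset_iff[OF assms(1) limp_Prop[OF assms(2,3)]]
    Prop_carrier[OF closure_Prop] assms by simp

lemma fusion_closure_subset_iff:
  assumes "X \<subseteq> carrier S" "Y \<subseteq> carrier S" "Z \<in> Prop S"
  shows "X \<bullet> j S (\<up>Y) \<subseteq> Z \<longleftrightarrow> X \<bullet> Y \<subseteq> Z"
  using subset_rimp_iff[of Y X Z] subset_rimp_iff[of "j S (\<up>Y)" X Z]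
    closure_subset_iff[OF assms(2) rimp_Prop[OF assms(1,3)]]
    Prop_carrier[OF closure_Prop] assms by simp

lemma closure_fusion_closure:
  assumes "X \<subseteq> carrier S" "Y \<subseteq> carrier S"
  shows "j S (\<up>(j S (\<up>X) \<bullet> j S (\<up>Y))) = j S (\<up>(X \<bullet> Y))"
proof (rule subset_antisym)
  let ?W = "j S (\<up>(X \<bullet> Y))"
  have cl: "j S (\<up>X) \<subseteq> carrier S" "j S (\<up>Y) \<subseteq> carrier S"
    by (rule Prop_carrier[OF closure_Prop])+
  \<comment> \<open>The closures are removed from the two factors one after the other; what remains
    is extensivity for \<open>X \<bullet> Y\<close>.\<close>
  have "j S (\<up>X) \<bullet> j S (\<up>Y) \<subseteq> ?W"
    using assms cl closure_Prop closure_extensive[OF set_fusion_closed[OF assms]]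
    by (simp add: closure_fusion_subset_iff fusion_closure_subset_iff)
  then show "j S (\<up>(j S (\<up>X) \<bullet> j S (\<up>Y))) \<subseteq> ?W"
    by (simp add: closure_subset_iff set_fusion_closed cl closure_Prop)
  \<comment> \<open>Conversely, each factor is contained in its closure, so monotonicity
    suffices.\<close>
  show "?W \<subseteq> j S (\<up>(j S (\<up>X) \<bullet> j S (\<up>Y)))"
    by (intro closure_mono set_fusion_mono set_fusion_closed closure_extensive assms cl)
qed

lemma closure_fusion_left:
  "X \<subseteq> carrier S \<Longrightarrow> Y \<in> Prop S \<Longrightarrow> j S (\<up>(j S (\<up>X) \<bullet> Y)) = j S (\<up>(X \<bullet> Y))"
  using closure_fusion_closure[of X Y] by (simp add: closure_Prop_eq Prop_carrier)

lemma closure_fusion_right: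
  "X \<in> Prop S \<Longrightarrow> Y \<subseteq> carrier S \<Longrightarrow> j S (\<up>(X \<bullet> j S (\<up>Y))) = j S (\<up>(X \<bullet> Y))"
  using closure_fusion_closure[of X Y] by (simp add: closure_Prop_eq Prop_carrier)

text \<open>The axiom on covers inside \<open>\<up>{\<epsilon>}\<close> says precisely that this
  cone is closed under \<open>j\<close>.\<close>

lemma up_ident_Prop: "\<up>{\<epsilon>} \<in> Prop S"
  using up_set_up[of "{\<epsilon>}"] cover_ident by (auto simp: Prop_def j_def up_def)

lemma closure_ident: "j S (\<up>{\<epsilon>}) = \<up>{\<epsilon>}"
  using up_ident_Prop subset_j[OF up_set_up] by (auto simp: Prop_def)

text \<open>The nucleus identities drop the inner closures, so the monoid laws reduce to those of
  the complex product.\<close>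

lemma tensor_monoid_Prop:
  "monoid \<lparr>carrier = Prop S, mult = (\<lambda>X Y. j S (\<up>(X \<bullet> Y))), one = \<up>{\<epsilon>}\<rparr>"
proof (rule monoidI, simp_all add: closure_Prop up_ident_Prop)
  fix X Y Z assume "X \<in> Prop S" "Y \<in> Prop S" "Z \<in> Prop S"
  then show "j S (\<up>(j S (\<up>(X \<bullet> Y)) \<bullet> Z)) = j S (\<up>(X \<bullet> j S (\<up>(Y \<bullet> Z))))"
    by (simp add: closure_fusion_left closure_fusion_right set_fusion_closed Prop_carrier
        set_fusion_assoc)
next
  fix X assume X: "X \<in> Prop S"
  show "j S (\<up>(\<up>{\<epsilon>} \<bullet> X)) = X"
    \<comment> \<open>The unit is read as the closure of the single generator
      \<open>\<epsilon>\<close>, which turns the product into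
      \<open>{\<epsilon>} \<bullet> X\<close>.\<close>
    using closure_fusion_left[of "{\<epsilon>}", OF _ X] X
    by (simp add: closure_ident ident_closed set_fusion_ident_left Prop_carrier closure_Prop_eq)
  show "j S (\<up>(X \<bullet> \<up>{\<epsilon>})) = X"
    using closure_fusion_right[of _ "{\<epsilon>}", OF X] X
    by (simp add: closure_ident ident_closed set_fusion_ident_right Prop_carrier closure_Prop_eq)
qed

end

section \<open>The modalities\<close>

context modal_FL_cover_system
begin

lemma idems_carrier: "idems S \<subseteq> carrier S"
  using idems_subset by (auto simp: up_def)

lemma idems_above_ident: "x \<in> idems S \<Longrightarrow> \<epsilon> \<preceq> x"
  using idems_subset by (auto simp: up_def)

text \<open>Confluence moves an \<open>acc\<close>-witness upward along the order. Localisation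
  turns a cover inside \<open>dia S X\<close> into one successor of \<open>x\<close> with a cover
  inside \<open>X\<close>; this successor is in \<open>X\<close> because \<open>X\<close> is a
  proposition.\<close>

lemma dia_Prop:
  assumes X: "X \<in> Prop S"
  shows "dia S X \<in> Prop S"
proof (rule PropI)
  fix x y assume "x \<in> dia S X" "x \<preceq> y"
  then show "y \<in> dia S X"
    using acc_confluence[of x y] Prop_upward[OF X] below_carrier[of x y] by (fastforce simp: dia_def)
next
  fix x C assume x: "x \<lhd> C" "C \<subseteq> dia S X"
  then obtain y D where "(x, y) \<in> acc S" "y \<lhd> D" "D \<subseteq> X"
    using acc_localisation[OF Prop_carrier[OF X]] by blast
  then show "x \<in> dia S X" using Prop_cover[OF X] cover_carrier[OF x(1)] by (auto simp: dia_def)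
qed (auto simp: dia_def)

text \<open>The source of (s4): a product of elements above \<open>\<epsilon>\<close> lies above
  both factors, and conversely an idempotent \<open>z\<close> in both sets factors as
  \<open>z \<cdot> z\<close>.\<close>

lemma idems_fusion:
  assumes "X \<in> Prop S" "Y \<in> Prop S"
  shows "(X \<inter> idems S) \<bullet> (Y \<inter> idems S) = X \<inter> Y \<inter> idems S"
proof (intro subset_antisym subsetI)
  fix z assume "z \<in> (X \<inter> idems S) \<bullet> (Y \<inter> idems S)"
  then obtain x y where z: "z = x \<cdot> y" and x: "x \<in> X" "x \<in> idems S" and y: "y \<in> Y" "y \<in> idems S"
    by (auto simp: mem_set_fusion)
  have c: "x \<in> carrier S" "y \<in> carrier S" using x y idems_carrier by auto
  \<comment> \<open>Here \<open>x = x \<cdot> \<epsilon> \<preceq> x \<cdot> y\<close>, since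
    \<open>\<epsilon> \<preceq> y\<close>.\<close>
  have "x \<preceq> z" using fusion_mono_right[OF idems_above_ident[OF y(2)] c(1)] c z
    by (simp add: ident_right)
  moreover have "y \<preceq> z" using fusion_mono_left[OF idems_above_ident[OF x(2)] c(2)] c z
    by (simp add: ident_left)
  ultimately show "z \<in> X \<inter> Y \<inter> idems S"
    using x y z assms by (auto intro: idems_closed Prop_upward)
next
  fix z assume "z \<in> X \<inter> Y \<inter> idems S"
  then show "z \<in> (X \<inter> idems S) \<bullet> (Y \<inter> idems S)"
    using idems_idem[of z] by (auto simp: mem_set_fusion)
qed

lemma idems_commute:
  assumes "Y \<subseteq> carrier S"
  shows "(X \<inter> idems S) \<bullet> Y = Y \<bullet> (X \<inter> idems S)"
proof -
  have comm: "x \<cdot> y = y \<cdot> x" if "x \<in> idems S" "y \<in> Y" for x y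
    using that assms idems_central by blast
  show ?thesis
  proof (intro subset_antisym subsetI)
    fix w assume "w \<in> (X \<inter> idems S) \<bullet> Y"
    then obtain x y where "w = x \<cdot> y" "x \<in> X \<inter> idems S" "y \<in> Y"
      by (auto simp: mem_set_fusion)
    then show "w \<in> Y \<bullet> (X \<inter> idems S)"
      using comm[of x y] set_fusionI[of y Y x "X \<inter> idems S"] by simp
  next
    fix w assume "w \<in> Y \<bullet> (X \<inter> idems S)"
    then obtain x y where "w = y \<cdot> x" "x \<in> X \<inter> idems S" "y \<in> Y"
      by (auto simp: mem_set_fusion)
    then show "w \<in> (X \<inter> idems S) \<bullet> Y"
      using comm[of x y] set_fusionI[of x "X \<inter> idems S" y Y] by simp
  qed
qed

section \<open>The modality \<open>!\<close> and its interaction with \<open>?\<close>\<close>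

lemma bang_subset_iff: "Z \<in> Prop S \<Longrightarrow> j S (\<up>(X \<inter> idems S)) \<subseteq> Z \<longleftrightarrow> X \<inter> idems S \<subseteq> Z"
  using idems_carrier by (intro closure_subset_iff) auto

lemma subset_bang: "X \<inter> idems S \<subseteq> j S (\<up>(X \<inter> idems S))"
  using bang_subset_iff closure_Prop by blast

lemma bang_ident: "j S (\<up>(\<up>{\<epsilon>} \<inter> idems S)) = \<up>{\<epsilon>}"
proof (rule subset_antisym)
  show "j S (\<up>(\<up>{\<epsilon>} \<inter> idems S)) \<subseteq> \<up>{\<epsilon>}"
    using bang_subset_iff[OF up_ident_Prop] by blast
  \<comment> \<open>The generator \<open>\<epsilon>\<close> of the unit belongs to both intersected
    sets, so its closure is below the closure of the intersection.\<close>
  have "\<epsilon> \<in> \<up>{\<epsilon>}" using subset_up ident_closed by blast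
  then have "j S (\<up>{\<epsilon>}) \<subseteq> j S (\<up>(\<up>{\<epsilon>} \<inter> idems S))"
    using ident_idems idems_carrier by (intro closure_mono) auto
  then show "\<up>{\<epsilon>} \<subseteq> j S (\<up>(\<up>{\<epsilon>} \<inter> idems S))" by (simp add: closure_ident)
qed

text \<open>This is (c1) for the left residual. The target is a proposition, so only
  \<open>z\<close> in \<open>idems S\<close> need be tested: if \<open>x\<close> is related to
  \<open>y\<close> in \<open>X\<close>, then \<open>z \<cdot> x\<close> is related to
  \<open>z \<cdot> y\<close>, which is in \<open>Y\<close>.\<close>

lemma bang_limp_subset:
  assumes X: "X \<in> Prop S" and Y: "Y \<in> Prop S"
  shows "j S (\<up>({z \<in> carrier S. {z} \<bullet> X \<subseteq> Y} \<inter> idems S))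
    \<subseteq> {z \<in> carrier S. {z} \<bullet> dia S X \<subseteq> dia S Y}"
proof -
  have P: "{z \<in> carrier S. {z} \<bullet> dia S X \<subseteq> dia S Y} \<in> Prop S"
    using X Y by (intro limp_Prop Prop_carrier dia_Prop)
  have "z \<cdot> x \<in> dia S Y"
    if "z \<in> carrier S" "{z} \<bullet> X \<subseteq> Y" "z \<in> idems S" "x \<in> dia S X" for z x
    using that acc_fusion_left[of z x] fusion_closed[of z x]
    by (fastforce simp: dia_def mem_set_fusion)
  then show ?thesis unfolding bang_subset_iff[OF P] by (auto simp: mem_set_fusion)
qed

lemma bang_rimp_subset:
  assumes X: "X \<in> Prop S" and Y: "Y \<in> Prop S"
  shows "j S (\<up>({z \<in> carrier S. X \<bullet> {z} \<subseteq> Y} \<inter> idems S))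
    \<subseteq> {z \<in> carrier S. dia S X \<bullet> {z} \<subseteq> dia S Y}"
proof -
  have P: "{z \<in> carrier S. dia S X \<bullet> {z} \<subseteq> dia S Y} \<in> Prop S"
    using X Y by (intro rimp_Prop Prop_carrier dia_Prop)
  have "x \<cdot> z \<in> dia S Y"
    if "z \<in> carrier S" "X \<bullet> {z} \<subseteq> Y" "z \<in> idems S" "x \<in> dia S X" for z x
    using that acc_fusion_right[of z x] fusion_closed[of x z]
    by (fastforce simp: dia_def mem_set_fusion)
  then show ?thesis unfolding bang_subset_iff[OF P] by (auto simp: mem_set_fusion)
qed

lemma subset_dia: "X \<in> Prop S \<Longrightarrow> X \<subseteq> dia S X"
  using acc_refl Prop_carrier[of X] by (auto simp: dia_def refl_on_def)

lemma dia_dia: "dia S (dia S X) \<subseteq> dia S X"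
  using acc_trans by (auto simp: dia_def dest: transD)

lemma dia_falsum: "dia S (falsum S) \<subseteq> falsum S"
  by (auto simp: dia_def dest: acc_falsum)

text \<open>Each point of \<open>falsum S\<close> has a successor covered by the empty set, and such
  a successor lies in every proposition.\<close>

lemma falsum_subset_dia: "X \<in> Prop S \<Longrightarrow> falsum S \<subseteq> dia S X"
  using Prop_carrier[OF falsum_Prop] by (fastforce simp: dia_def dest: falsum_acc intro: Prop_cover)

section \<open>The algebra of propositions\<close>

lemma prop_algebra_simps:
  "carrier (\<^bold>L S) = Prop S" "le (\<^bold>L S) = (\<subseteq>)" "eq (\<^bold>L S) = (=)"
  "tensor (\<^bold>L S) = (\<lambda>X Y. j S (\<up>(X \<bullet> Y)))" "unit (\<^bold>L S) = \<up>{\<epsilon>}"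
  "limp (\<^bold>L S) = (\<lambda>X Y. {z \<in> carrier S. {z} \<bullet> X \<subseteq> Y})"
  "rimp (\<^bold>L S) = (\<lambda>X Y. {z \<in> carrier S. X \<bullet> {z} \<subseteq> Y})"
  "zeroL (\<^bold>L S) = falsum S" "bang (\<^bold>L S) = (\<lambda>X. j S (\<up>(X \<inter> idems S)))"
  "quest (\<^bold>L S) = dia S"
  by (simp_all add: prop_algebra_def)

lemma Inter_is_glb:
  assumes "A \<subseteq> Prop S"
  shows "is_glb (\<^bold>L S) (carrier S \<inter> \<Inter>A) A"
  using assms Inter_Prop[OF assms] Prop_carrier
  by (auto simp: greatest_def Lower_def prop_algebra_simps)

lemma j_Union_is_lub:
  assumes "A \<subseteq> Prop S"
  shows "is_lub (\<^bold>L S) (j S (\<Union>A)) A"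
proof -
  have "j S (\<Union>A) \<subseteq> Z \<longleftrightarrow> \<Union>A \<subseteq> Z" if "Z \<in> Prop S" for Z
    using j_subset_iff[OF Union_up_set[OF assms] that] .
  then show ?thesis
    using j_Prop[OF Union_up_set[OF assms]] subset_j[OF Union_up_set[OF assms]] assms
    by (auto simp: least_def Upper_def prop_algebra_simps subset_iff)
qed

section \<open>The complete lattice of propositions\<close>

lemma prop_algebra_partial_order: "partial_order (\<^bold>L S)"
  by unfold_locales (auto simp: prop_algebra_simps)

lemma prop_algebra_complete_lattice: "complete_lattice (\<^bold>L S)"
proof (rule partial_order.complete_latticeI[OF prop_algebra_partial_order])
  fix A assume "A \<subseteq> carrier (\<^bold>L S)"
  then have A: "A \<subseteq> Prop S" by (simp add: prop_algebra_simps)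
  show "\<exists>s. is_lub (\<^bold>L S) s A" using j_Union_is_lub[OF A] by blast
  show "\<exists>i. is_glb (\<^bold>L S) i A" using Inter_is_glb[OF A] by blast
qed

lemma prop_algebra_Inf:
  assumes "A \<subseteq> Prop S"
  shows "\<Sqinter>\<^bsub>\<^bold>L S\<^esub>A = carrier S \<inter> \<Inter>A"
  \<comment> \<open>The infimum is a chosen greatest lower bound; antisymmetry makes it unique and
    so identifies it with the intersection.\<close>
  unfolding Lattice.inf_def
  using Inter_is_glb[OF assms]
  by (rule some_equality)
    (rule partial_order.greatest_unique[OF prop_algebra_partial_order _ Inter_is_glb[OF assms]])

lemma prop_algebra_Sup:
  assumes "A \<subseteq> Prop S"
  shows "\<Squnion>\<^bsub>\<^bold>L S\<^esub>A = j S (\<Union>A)"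
  unfolding Lattice.sup_def
  using j_Union_is_lub[OF assms]
  by (rule some_equality)
    (rule partial_order.least_unique[OF prop_algebra_partial_order _ j_Union_is_lub[OF assms]])

lemma prop_algebra_meet:
  "X \<in> Prop S \<Longrightarrow> Y \<in> Prop S \<Longrightarrow> X \<sqinter>\<^bsub>\<^bold>L S\<^esub> Y = X \<inter> Y"
  using Prop_carrier[of X] by (auto simp: meet_def prop_algebra_Inf)

lemma prop_algebra_bounded_lattice: "bounded_lattice (\<^bold>L S)"
proof -
  interpret L: complete_lattice "\<^bold>L S" by (rule prop_algebra_complete_lattice)
  show ?thesis ..
qed

lemma prop_algebra_top: "\<top>\<^bsub>\<^bold>L S\<^esub> = carrier S"
  using bounded_lattice.top_eq[OF prop_algebra_bounded_lattice, of "carrier S"]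
  by (simp add: prop_algebra_simps carrier_Prop Prop_carrier)

lemma prop_algebra_bottom: "\<bottom>\<^bsub>\<^bold>L S\<^esub> = j S {}"
  \<comment> \<open>The empty set is an up-set, being the union of the empty family, so
    \<open>j S {}\<close> is a proposition below every other.\<close>
  using bounded_lattice.bottom_eq[OF prop_algebra_bounded_lattice, of "j S {}"]
    Union_up_set[of "{}"]
  by (simp add: prop_algebra_simps j_Prop j_subset_iff)

lemma prop_algebra_modal_FL_algebra: "modal_FL_algebra (\<^bold>L S)"
proof -
  \<comment> \<open>These two interpretations settle the lattice and monoid obligations, leaving
    only residuation and the modal laws.\<close>
  interpret L: bounded_lattice "\<^bold>L S" by (rule prop_algebra_bounded_lattice)
  interpret tensor: monoid "\<lparr>carrier = carrier (\<^bold>L S), mult = tensor (\<^bold>L S), one = unit (\<^bold>L S)\<rparr>"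
    unfolding prop_algebra_simps by (rule tensor_monoid_Prop)
  have tensor_subset_iff: "j S (\<up>(X \<bullet> Y)) \<subseteq> Z \<longleftrightarrow> X \<bullet> Y \<subseteq> Z"
    if "X \<in> Prop S" "Y \<in> Prop S" "Z \<in> Prop S" for X Y Z
    using that by (intro closure_subset_iff set_fusion_closed Prop_carrier)
  show ?thesis
  proof (unfold_locales, unfold prop_algebra_simps)
    fix X Y Z W assume "X \<in> Prop S" "Y \<in> Prop S" "Z \<in> Prop S" "W \<in> Prop S" "X \<subseteq> Y" "Z \<subseteq> W"
    then show "j S (\<up>(X \<bullet> Z)) \<subseteq> j S (\<up>(Y \<bullet> W))"
      by (intro closure_mono set_fusion_mono set_fusion_closed Prop_carrier)
  next
    fix X Y assume XY: "X \<in> Prop S" "Y \<in> Prop S"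
    show "{z \<in> carrier S. {z} \<bullet> X \<subseteq> Y} \<in> Prop S" "{z \<in> carrier S. X \<bullet> {z} \<subseteq> Y} \<in> Prop S"
      using XY by (simp_all add: limp_Prop rimp_Prop Prop_carrier)
    show "j S (\<up>(X \<sqinter>\<^bsub>\<^bold>L S\<^esub> Y \<inter> idems S))
        = j S (\<up>(j S (\<up>(X \<inter> idems S)) \<bullet> j S (\<up>(Y \<inter> idems S))))"
      \<comment> \<open>For (s4), the nucleus identity leaves the product of the two generating
        sets, which is \<open>X \<inter> Y \<inter> idems S\<close>.\<close>
      using XY idems_carrier
      by (subst closure_fusion_closure) (auto simp: prop_algebra_meet idems_fusion)
    show "j S (\<up>(j S (\<up>(X \<inter> idems S)) \<bullet> Y)) = j S (\<up>(Y \<bullet> j S (\<up>(X \<inter> idems S))))"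
      using XY idems_carrier idems_commute[OF Prop_carrier[OF XY(2)], of X]
      by (simp add: closure_fusion_left closure_fusion_right le_infI2)
  next
    fix X Y Z assume XYZ: "X \<in> Prop S" "Y \<in> Prop S" "Z \<in> Prop S"
    then show "X \<subseteq> {z \<in> carrier S. {z} \<bullet> Y \<subseteq> Z} \<longleftrightarrow> j S (\<up>(X \<bullet> Y)) \<subseteq> Z"
      and "Y \<subseteq> {z \<in> carrier S. X \<bullet> {z} \<subseteq> Z} \<longleftrightarrow> j S (\<up>(X \<bullet> Y)) \<subseteq> Z"
      by (simp_all only: tensor_subset_iff subset_limp_iff subset_rimp_iff Prop_carrier)
  next
    fix X assume X: "X \<in> Prop S"
    show "j S (\<up>(X \<inter> idems S)) \<subseteq> X" using bang_subset_iff[OF X] by blast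
    show "j S (\<up>(X \<inter> idems S)) \<subseteq> j S (\<up>(j S (\<up>(X \<inter> idems S)) \<inter> idems S))"
      \<comment> \<open>For (s2), a generator in \<open>X \<inter> idems S\<close> lies in
        \<open>!X\<close> and is still in \<open>idems S\<close>, so it also generates
        \<open>!!X\<close>.\<close>
      using subset_bang[of X] subset_bang[of "j S (\<up>(X \<inter> idems S))"]
      unfolding bang_subset_iff[OF closure_Prop] by blast
  qed (simp_all only: falsum_Prop closure_Prop dia_Prop bang_ident bang_limp_subset
      bang_rimp_subset subset_dia dia_dia dia_falsum falsum_subset_dia)
qed

end

theorem theorem2:
  fixes S :: "'a modal_FL_cover_struct"
  assumes "modal_FL_cover_system S"
  shows "modal_FL_algebra (\<^bold>L S) \<and> complete_lattice (\<^bold>L S)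
    \<and> (\<forall>A \<subseteq> Prop S. \<Sqinter>\<^bsub>\<^bold>L S\<^esub>A = carrier S \<inter> \<Inter>A \<and> \<Squnion>\<^bsub>\<^bold>L S\<^esub>A = j S (\<Union>A))
    \<and> \<top>\<^bsub>\<^bold>L S\<^esub> = carrier S \<and> \<bottom>\<^bsub>\<^bold>L S\<^esub> = j S {}"
proof -
  interpret modal_FL_cover_system S by (rule assms)
  show ?thesis
    by (simp add: prop_algebra_modal_FL_algebra prop_algebra_complete_lattice prop_algebra_Inf
        prop_algebra_Sup prop_algebra_top prop_algebra_bottom)
qed

end
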